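(* There exist universal polynomials $C_0=C_0(n)>0$ and $C=C(n)>0$ such that the following holds. Let $\boldsymbol{A}\in\mathbb{R}^{n\times n}$ be invertible, let $\boldsymbol{b}\in\mathbb{R}^n$, and let $\boldsymbol{x}:=\boldsymbol{A}^{-1}\boldsymbol{b}$. Let $\widehat{\boldsymbol{x}}_k$ be the output of $k$ iterations of randomized Kaczmarz with initial input $\widehat{\boldsymbol{x}}_0$, executed in floating-point arithmetic with unit roundoff $u$. Assume $\|\widehat{\boldsymbol{x}}_0\|\le\|\boldsymbol{x}\|$ and $\tilde\kappa(\boldsymbol{A})^2u\ll 1$, i.e. $\tilde\kappa(\boldsymbol{A})^2u\le 1/C_0(n)$. Then for every $k\ge 0$ $$\mathbb{E}\,\|\widehat{\boldsymbol{x}}_k-\boldsymbol{x}\|\le\left(1-\frac{1}{2\tilde\kappa(\boldsymbol{A})^2}\right)^k\|\widehat{\boldsymbol{x}}_0-\boldsymbol{x}\|+C\,\|\boldsymbol{x}\|\,\tilde\kappa(\boldsymbol{A})^2u.$$ In particular, when the method is run for a suitable total number $k=\mathcal{O}(\tilde\kappa(\boldsymbol{A})^2\log(1/u))$ of iterations (absolute implied constant), the output satisfies $$\mathbb{E}\,\|\widehat{\boldsymbol{x}}_k-\boldsymbol{x}\|\lesssim\|\boldsymbol{x}\|\,\tilde\kappa(\boldsymbol{A})^2u.$$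
   Context: Norms: $\|\cdot\|$ is the vector $\ell_2$ norm and its induced operator norm; $\|\cdot\|_{\rm F}$ is the Frobenius norm. The Demmel condition number is $\tilde\kappa(\boldsymbol{A})=\|\boldsymbol{A}\|_{\rm F}\|\boldsymbol{A}^{-1}\|$. Asymptotic notation: $a\lesssim b$ means $a\le C(n)b$ for a fixed universal (unspecified) polynomial $C(n)>0$; $a\ll b$ means $a\le b/C(n)$ for a sufficiently large universal polynomial $C(n)>0$. Randomized Kaczmarz: with $\boldsymbol{a}_i^\top$ the $i$th row of $\boldsymbol{A}$ and $b_i$ the $i$th entry of $\boldsymbol{b}$, iteration $k=0,1,2,\dots$ draws (independently of the past) a row index $r(k)$ with $\Pr[r(k)=i]=\|\boldsymbol{a}_i\|^2/\|\boldsymbol{A}\|_{\rm F}^2$ and sets $$\boldsymbol{x}_{k+1}=\boldsymbol{x}_k+\frac{b_{r(k)}-\langle\boldsymbol{a}_{r(k)},\boldsymbol{x}_k\rangle}{\langle\boldsymbol{a}_{r(k)},\boldsymbol{a}_{r(k)}\rangle}\boldsymbol{a}_{r(k)}.$$ In floating-point execution, $\widehat{\boldsymbol{x}}_{k+1}$ is the result of evaluating this update in floating-point arithmetic, in the natural way, on input $\widehat{\boldsymbol{x}}_k$. The expectation is over the random row indices. Floating-point model (standard model, unit roundoff $u$, no overflow/underflow): the rounding function $\mathrm{fl}$ satisfies $|\mathrm{fl}(x)-x|\le u|x|$ for all $x\in\mathbb{R}$, and for exactly represented scalars $a,b$ and $\mathrm{op}\in\{+,-,\times,\div\}$ the computed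 value of $a\,\mathrm{op}\,b$ differs from $a\,\mathrm{op}\,b$ by at most $u\,|a\,\mathrm{op}\,b|$. Vector operations, inner products and matrix–vector products are computed by the standard routines from these scalar operations. The entries of $\boldsymbol{A}$, $\boldsymbol{b}$ and $\widehat{\boldsymbol{x}}_0$ are exactly represented, and the row indices are sampled with the stated probabilities. *)

theory Defs
  imports
    "Jordan_Normal_Form.Gauss_Jordan_Elimination"
    "HOL-Computational_Algebra.Polynomial"
    "HOL-Probability.Probability_Mass_Function"
    "HOL-Probability.Product_PMF"
begin

(* The dimension n is quantified inside the theorem, so vectors and matrices are those of
   Jordan_Normal_Form; the notation of the type-indexed vectors of HOL-Analysis is hidden. *)
unbundle no vec_syntax
hide_type (open) Finite_Cartesian_Product.vec
hide_const (open) Finite_Cartesian_Product.vec Finite_Cartesian_Product.row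

definition vnorm :: "real vec \<Rightarrow> real" where
  "vnorm v = sqrt (\<Sum>i<dim_vec v. (v $ i)\<^sup>2)"

definition opnorm :: "real mat \<Rightarrow> real" where
  "opnorm M = (SUP v \<in> {v \<in> carrier_vec (dim_col M). vnorm v \<le> 1}. vnorm (M *\<^sub>v v))"

definition frobenius_norm :: "real mat \<Rightarrow> real" where
  "frobenius_norm M = sqrt (\<Sum>i<dim_row M. \<Sum>j<dim_col M. (M $$ (i, j))\<^sup>2)"

definition inv_mat :: "real mat \<Rightarrow> real mat" where
  "inv_mat A = the (mat_inverse A)"

definition demmel_cond :: "real mat \<Rightarrow> real" where
  "demmel_cond A = frobenius_norm A * opnorm (inv_mat A)"

lemma inv_mat_inverse:
  assumes "A \<in> carrier_mat n n" "invertible_mat A"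
  shows "inv_mat A \<in> carrier_mat n n" "A * inv_mat A = 1\<^sub>m n" "inv_mat A * A = 1\<^sub>m n"
proof -
  from assms obtain B where B: "A * B = 1\<^sub>m n" "B * A = 1\<^sub>m (dim_row B)"
    unfolding invertible_mat_def inverts_mat_def by auto
  have "dim_col B = n"
    using arg_cong[OF B(1), of dim_col] by simp
  moreover have "dim_row B = n"
    using arg_cong[OF B(2), of dim_col] assms(1) by simp
  ultimately have Bc: "B \<in> carrier_mat n n" by auto
  with B assms(1) have U: "A \<in> Units (ring_mat TYPE(real) n ())"
    unfolding Units_def by (auto simp: ring_mat_simps)
  then obtain C where C: "mat_inverse A = Some C"
    using mat_inverse(1)[OF assms(1), where b = "()"] by (cases "mat_inverse A") auto
  from mat_inverse(2)[OF assms(1) C]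
  show "inv_mat A \<in> carrier_mat n n" "A * inv_mat A = 1\<^sub>m n" "inv_mat A * A = 1\<^sub>m n"
    by (auto simp: inv_mat_def C)
qed

(* A floating-point arithmetic: the set of exactly represented reals, the rounding function,
   and the computed scalar operations. *)
record fp_arith =
  floats :: "real set"
  fl :: "real \<Rightarrow> real"
  fadd :: "real \<Rightarrow> real \<Rightarrow> real"
  fsub :: "real \<Rightarrow> real \<Rightarrow> real"
  fmul :: "real \<Rightarrow> real \<Rightarrow> real"
  fdiv :: "real \<Rightarrow> real \<Rightarrow> real"

(* The standard model with unit roundoff u and without overflow or underflow.  Neither
   monotonicity nor correct rounding is required: the computed operations need not be
   the rounded exact ones. *)
definition standard_fp_model :: "real \<Rightarrow> fp_arith \<Rightarrow> bool" where
  "standard_fp_model u F \<longleftrightarrow>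
     0 \<le> u \<and>
     (\<forall>x. fl F x \<in> floats F \<and> \<bar>fl F x - x\<bar> \<le> u * \<bar>x\<bar>) \<and>
     (\<forall>a \<in> floats F. \<forall>b \<in> floats F.
        fadd F a b \<in> floats F \<and> \<bar>fadd F a b - (a + b)\<bar> \<le> u * \<bar>a + b\<bar> \<and>
        fsub F a b \<in> floats F \<and> \<bar>fsub F a b - (a - b)\<bar> \<le> u * \<bar>a - b\<bar> \<and>
        fmul F a b \<in> floats F \<and> \<bar>fmul F a b - (a * b)\<bar> \<le> u * \<bar>a * b\<bar> \<and>
        (b \<noteq> 0 \<longrightarrow> fdiv F a b \<in> floats F \<and> \<bar>fdiv F a b - (a / b)\<bar> \<le> u * \<bar>a / b\<bar>))"

(* The loop s := 0; for i = 0, ..., n - 1 do s := s + v_i * w_i, every operation rounded. *)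
definition fp_inner :: "fp_arith \<Rightarrow> real vec \<Rightarrow> real vec \<Rightarrow> real" where
  "fp_inner F v w = foldl (\<lambda>s i. fadd F s (fmul F (v $ i) (w $ i))) 0 [0..<dim_vec v]"

definition fp_scale :: "fp_arith \<Rightarrow> real \<Rightarrow> real vec \<Rightarrow> real vec" where
  "fp_scale F c v = map_vec (fmul F c) v"

definition fp_vec_add :: "fp_arith \<Rightarrow> real vec \<Rightarrow> real vec \<Rightarrow> real vec" where
  "fp_vec_add F v w = vec (dim_vec v) (\<lambda>j. fadd F (v $ j) (w $ j))"

definition fp_kaczmarz_step :: "fp_arith \<Rightarrow> real mat \<Rightarrow> real vec \<Rightarrow> nat \<Rightarrow> real vec \<Rightarrow> real vec" where
  "fp_kaczmarz_step F A b i x =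
     (let a = row A i in
      fp_vec_add F x (fp_scale F (fdiv F (fsub F (b $ i) (fp_inner F a x)) (fp_inner F a a)) a))"

primrec fp_kaczmarz ::
  "fp_arith \<Rightarrow> real mat \<Rightarrow> real vec \<Rightarrow> real vec \<Rightarrow> (nat \<Rightarrow> nat) \<Rightarrow> nat \<Rightarrow> real vec" where
  "fp_kaczmarz F A b x0 r 0 = x0"
| "fp_kaczmarz F A b x0 r (Suc k) = fp_kaczmarz_step F A b (r k) (fp_kaczmarz F A b x0 r k)"

definition row_pmf :: "real mat \<Rightarrow> nat pmf" where
  "row_pmf A = embed_pmf (\<lambda>i. if i < dim_row A
     then (vnorm (row A i))\<^sup>2 / (frobenius_norm A)\<^sup>2 else 0)"

(* embed_pmf is meaningful only if the weights sum to one, which holds for nonzero A. *)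
lemma pmf_row_pmf:
  assumes "frobenius_norm A \<noteq> 0"
  shows "pmf (row_pmf A) i =
    (if i < dim_row A then (vnorm (row A i))\<^sup>2 / (frobenius_norm A)\<^sup>2 else 0)"
proof -
  let ?w = "\<lambda>i. if i < dim_row A then (vnorm (row A i))\<^sup>2 / (frobenius_norm A)\<^sup>2 else 0"
  have fro: "(frobenius_norm A)\<^sup>2 = (\<Sum>i<dim_row A. (vnorm (row A i))\<^sup>2)"
    unfolding frobenius_norm_def vnorm_def by (simp add: sum_nonneg)
  have "(\<integral>\<^sup>+ i. ennreal (?w i) \<partial>count_space UNIV) = (\<Sum>i<dim_row A. ennreal (?w i))"
    by (rule nn_integral_count_space'[where A = "{..<dim_row A}"]) auto
  also have "\<dots> = ennreal (\<Sum>i<dim_row A. ?w i)"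
    by (rule sum_ennreal) auto
  also have "(\<Sum>i<dim_row A. ?w i) = 1"
    using assms by (simp add: fro[symmetric] flip: sum_divide_distrib)
  finally show ?thesis
    unfolding row_pmf_def by (subst pmf_embed_pmf) auto
qed

(* The row indices r 0, ..., r (k - 1) on which the k-th iterate depends are independent, each
   with law row_pmf A. *)
definition expected_error ::
  "fp_arith \<Rightarrow> real mat \<Rightarrow> real vec \<Rightarrow> real vec \<Rightarrow> real vec \<Rightarrow> nat \<Rightarrow> real" where
  "expected_error F A b x0 x k =
     measure_pmf.expectation (Pi_pmf {..<k} 0 (\<lambda>_. row_pmf A))
       (\<lambda>r. vnorm (fp_kaczmarz F A b x0 r k - x))"

end

theory Submission
  imports Defs
begin

unbundle no inner_syntax

text \<open>
  Write \<open>e\<^sub>k\<close> for the error of the \<open>k\<close>-th iterate and \<open>\<kappa>\<close> for the Demmel condition number. An exact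
  Kaczmarz step removes from \<open>e\<^sub>k\<close> its component along the chosen row. Since rows are drawn with
  probability proportional to their squared length, the average of the squared length removed is
  \<open>\<parallel>A e\<^sub>k\<parallel>\<^sup>2 / \<parallel>A\<parallel>\<^sub>F\<^sup>2 \<ge> \<parallel>e\<^sub>k\<parallel>\<^sup>2 / \<kappa>\<^sup>2\<close>, so an exact step contracts the expected error by
  \<open>1 - 1/(2 \<kappa>\<^sup>2)\<close> (\<open>expected_exact_step_le\<close>).

  In floating-point arithmetic the step acquires an additional error of norm at most
  \<open>136 n\<^sup>2 u (\<parallel>x\<parallel> + \<parallel>x\<^sub>k\<parallel>)\<close>, where \<open>x\<^sub>k\<close> is the computed iterate (\<open>fp_kaczmarz_step_error\<close>): the
  rounding error of the residual is \<open>O(n u)\<close> times the norm of the row times \<open>\<parallel>x\<parallel> + \<parallel>x\<^sub>k\<parallel>\<close>, and the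
  norm of the row cancels when the step is formed. Averaging over
  the last row, and bounding \<open>\<parallel>x\<^sub>k\<parallel>\<close> by \<open>\<parallel>x\<parallel> + \<parallel>e\<^sub>k\<parallel>\<close>, gives for \<open>E\<^sub>k\<close>, the expectation of \<open>\<parallel>e\<^sub>k\<parallel>\<close>,
  the recursion (\<open>expected_error_Suc_le\<close>)
  \<open>E\<^sub>k\<^sub>+\<^sub>1 \<le> (1 - 1/(2 \<kappa>\<^sup>2)) E\<^sub>k + c (\<parallel>x\<parallel> + E\<^sub>k)\<close> with \<open>c = 272 n\<^sup>2 u\<close>.

  It remains to solve this recursion without loss in the rate (\<open>perturbed_contraction_bound\<close>). When
  \<open>\<kappa>\<^sup>2 u\<close> is small, \<open>E\<^sub>k \<le> 3 \<parallel>x\<parallel>\<close> is an invariant, because the contraction gains \<open>3 \<parallel>x\<parallel> / (2 \<kappa>\<^sup>2)\<close>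
  while the perturbation costs at most \<open>4 c \<parallel>x\<parallel>\<close>. The perturbation is then a constant, and its
  accumulation at rate \<open>1 - 1/(2 \<kappa>\<^sup>2)\<close> is at most \<open>2 \<kappa>\<^sup>2 \<cdot> 4 c \<parallel>x\<parallel>\<close>, a multiple of \<open>\<parallel>x\<parallel> \<kappa>\<^sup>2 u\<close>. After
  \<open>2 \<kappa>\<^sup>2 ln (1/u)\<close> steps the contribution of the initial error is at most \<open>u \<parallel>x0 - x\<parallel>\<close>.
\<close>

section \<open>Euclidean and operator norms\<close>

lemma vnorm_eq_L2_set: "vnorm v = L2_set (\<lambda>i. v $ i) {..<dim_vec v}"
  by (simp add: vnorm_def L2_set_def)

lemma vnorm_nonneg [simp]: "0 \<le> vnorm v"
  by (simp add: vnorm_eq_L2_set)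

lemma vnorm_sq: "(vnorm v)\<^sup>2 = v \<bullet> v"
  by (simp add: vnorm_def scalar_prod_def sum_nonneg power2_eq_square lessThan_atLeast0)

lemma vnorm_eq_0_iff: "vnorm v = 0 \<longleftrightarrow> v = 0\<^sub>v (dim_vec v)"
  by (auto simp: vnorm_eq_L2_set L2_set_eq_0_iff intro!: eq_vecI) (metis index_zero_vec(1))

lemma vnorm_add_le:
  assumes "v \<in> carrier_vec n" "w \<in> carrier_vec n"
  shows "vnorm (v + w) \<le> vnorm v + vnorm w"
proof -
  have "vnorm (v + w) = L2_set (\<lambda>i. v $ i + w $ i) {..<n}"
    using assms by (auto simp: vnorm_eq_L2_set intro!: L2_set_cong)
  also have "\<dots> \<le> vnorm v + vnorm w"
    using assms by (simp add: vnorm_eq_L2_set L2_set_triangle_ineq)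
  finally show ?thesis .
qed

lemma vnorm_smult: "vnorm (c \<cdot>\<^sub>v v) = \<bar>c\<bar> * vnorm v"
  by (simp add: vnorm_def power_mult_distrib real_sqrt_mult flip: sum_distrib_left)

lemma vnorm_minus_le:
  assumes "v \<in> carrier_vec n" "w \<in> carrier_vec n"
  shows "vnorm (v - w) \<le> vnorm v + vnorm w"
proof -
  have "v - w = v + (- 1) \<cdot>\<^sub>v w"
    using assms by (intro eq_vecI) auto
  then show ?thesis
    using vnorm_add_le[of v n "(- 1) \<cdot>\<^sub>v w"] assms by (simp add: vnorm_smult)
qed

lemma abs_index_le_vnorm: "i < dim_vec v \<Longrightarrow> \<bar>v $ i\<bar> \<le> vnorm v"
  using member_le_L2_set[of "{..<dim_vec v}" i "\<lambda>i. \<bar>v $ i\<bar>"]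
  by (simp add: vnorm_eq_L2_set L2_set_def)

lemma vnorm_le_dim_mult:
  assumes "\<And>i. i < dim_vec v \<Longrightarrow> \<bar>v $ i\<bar> \<le> c"
  shows "vnorm v \<le> real (dim_vec v) * c"
proof -
  have "vnorm v \<le> (\<Sum>i<dim_vec v. \<bar>v $ i\<bar>)"
    by (simp add: vnorm_eq_L2_set L2_set_le_sum_abs)
  also have "\<dots> \<le> (\<Sum>i<dim_vec v. c)"
    by (intro sum_mono) (use assms in auto)
  finally show ?thesis by simp
qed

lemma sum_abs_prod_le_vnorm:
  assumes "dim_vec v = dim_vec w"
  shows "(\<Sum>i<dim_vec v. \<bar>v $ i * w $ i\<bar>) \<le> vnorm v * vnorm w"
  using L2_set_mult_ineq[of "\<lambda>i. v $ i" "\<lambda>i. w $ i" "{..<dim_vec v}"] assms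
  by (simp add: vnorm_eq_L2_set abs_mult)

lemma abs_scalar_prod_le_vnorm:
  assumes "dim_vec v = dim_vec w"
  shows "\<bar>v \<bullet> w\<bar> \<le> vnorm v * vnorm w"
proof -
  have "\<bar>v \<bullet> w\<bar> \<le> (\<Sum>i<dim_vec v. \<bar>v $ i * w $ i\<bar>)"
    using assms by (simp add: scalar_prod_def lessThan_atLeast0 sum_abs)
  also note sum_abs_prod_le_vnorm[OF assms]
  finally show ?thesis .
qed

lemma frobenius_norm_nonneg [simp]: "0 \<le> frobenius_norm M"
  by (simp add: frobenius_norm_def sum_nonneg)

lemma frobenius_norm_sq: "(frobenius_norm M)\<^sup>2 = (\<Sum>i<dim_row M. (vnorm (row M i))\<^sup>2)"
  by (simp add: frobenius_norm_def vnorm_def sum_nonneg)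

lemma vnorm_mult_mat_vec_sq:
  "(vnorm (M *\<^sub>v v))\<^sup>2 = (\<Sum>i<dim_row M. (row M i \<bullet> v)\<^sup>2)"
  by (simp add: vnorm_def sum_nonneg)

lemma vnorm_mult_le_frobenius:
  assumes "v \<in> carrier_vec (dim_col M)"
  shows "vnorm (M *\<^sub>v v) \<le> frobenius_norm M * vnorm v"
proof (rule power2_le_imp_le)
  have "(row M i \<bullet> v)\<^sup>2 \<le> (vnorm (row M i))\<^sup>2 * (vnorm v)\<^sup>2" for i
    using abs_scalar_prod_le_vnorm[of "row M i" v] assms
    by (metis abs_ge_zero carrier_vecD index_row(2) power2_abs power_mono power_mult_distrib)
  then show "(vnorm (M *\<^sub>v v))\<^sup>2 \<le> (frobenius_norm M * vnorm v)\<^sup>2"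
    by (simp add: vnorm_mult_mat_vec_sq frobenius_norm_sq power_mult_distrib
        sum_distrib_right sum_mono)
qed simp

text \<open>The supremum defining the operator norm is finite because the Frobenius norm bounds it;
  homogeneity then carries the bound from the unit ball to all vectors.\<close>

lemma vnorm_mult_le_opnorm:
  assumes v: "v \<in> carrier_vec (dim_col M)"
  shows "vnorm (M *\<^sub>v v) \<le> opnorm M * vnorm v"
proof (cases "vnorm v = 0")
  case True
  then show ?thesis
    using vnorm_mult_le_frobenius[OF v] by simp
next
  case False
  let ?S = "{v \<in> carrier_vec (dim_col M). vnorm v \<le> 1}"
  have bdd: "bdd_above ((\<lambda>v. vnorm (M *\<^sub>v v)) ` ?S)"
  proof (rule bdd_aboveI2)
    fix w assume "w \<in> ?S"
    then have w: "w \<in> carrier_vec (dim_col M)" "vnorm w \<le> 1" by auto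
    have "vnorm (M *\<^sub>v w) \<le> frobenius_norm M * vnorm w"
      by (rule vnorm_mult_le_frobenius[OF w(1)])
    also have "\<dots> \<le> frobenius_norm M"
      using w(2) by (simp add: mult_left_le)
    finally show "vnorm (M *\<^sub>v w) \<le> frobenius_norm M" .
  qed
  let ?w = "(1 / vnorm v) \<cdot>\<^sub>v v"
  have "?w \<in> ?S"
    using v False by (auto simp: vnorm_smult)
  then have "vnorm (M *\<^sub>v ?w) \<le> opnorm M"
    unfolding opnorm_def by (intro cSUP_upper bdd)
  moreover have "M *\<^sub>v ?w = (1 / vnorm v) \<cdot>\<^sub>v (M *\<^sub>v v)"
    using v by (intro mult_mat_vec) auto
  ultimately show ?thesis
    using False by (simp add: vnorm_smult field_simps less_le)
qed

lemma vnorm_le_opnorm_inv_mat: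
  assumes A: "A \<in> carrier_mat n n" "invertible_mat A" and e: "e \<in> carrier_vec n"
  shows "vnorm e \<le> opnorm (inv_mat A) * vnorm (A *\<^sub>v e)"
proof -
  note inv = inv_mat_inverse[OF A]
  have "e = inv_mat A *\<^sub>v (A *\<^sub>v e)"
    using assoc_mult_mat_vec[OF inv(1) A(1) e] inv(3) e by simp
  then show ?thesis
    using vnorm_mult_le_opnorm[of "A *\<^sub>v e" "inv_mat A"] inv(1) A(1)
    by (metis carrier_matD carrier_vec_dim_vec dim_mult_mat_vec)
qed

text \<open>This turns smallness of \<open>\<kappa>\<^sup>2 u\<close> into smallness of \<open>u\<close> itself, and it makes the contraction factor
  \<open>1 - 1/(2 \<kappa>\<^sup>2)\<close> nonnegative.\<close>

lemma demmel_cond_ge_1: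
  assumes n: "1 \<le> n" and A: "A \<in> carrier_mat n n" "invertible_mat A"
  shows "1 \<le> demmel_cond A"
proof -
  let ?e = "unit_vec n 0 :: real vec"
  have e: "?e \<in> carrier_vec n" by simp
  have "vnorm ?e \<noteq> 0"
    using n by (auto simp: vnorm_eq_0_iff vec_eq_iff)
  then have pos: "0 < vnorm ?e" by (simp add: less_le)
  have op: "0 < opnorm (inv_mat A)"
  proof (rule ccontr)
    assume "\<not> ?thesis"
    then have "opnorm (inv_mat A) * vnorm (A *\<^sub>v ?e) \<le> 0"
      by (simp add: mult_le_0_iff)
    with vnorm_le_opnorm_inv_mat[OF A e] pos show False by linarith
  qed
  have "vnorm ?e \<le> opnorm (inv_mat A) * vnorm (A *\<^sub>v ?e)"
    by (rule vnorm_le_opnorm_inv_mat[OF A e])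
  also have "\<dots> \<le> opnorm (inv_mat A) * (frobenius_norm A * vnorm ?e)"
    using op A(1) by (intro mult_left_mono vnorm_mult_le_frobenius) auto
  also have "\<dots> = demmel_cond A * vnorm ?e"
    by (simp add: demmel_cond_def)
  finally show ?thesis using pos by simp
qed

lemma vnorm_row_pos:
  assumes A: "A \<in> carrier_mat n n" "invertible_mat A" and i: "i < n"
  shows "0 < vnorm (row A i)"
proof (rule ccontr)
  note inv = inv_mat_inverse[OF A]
  assume "\<not> ?thesis"
  then have "vnorm (row A i) = 0" by (simp add: not_less order_antisym)
  then have "row A i = 0\<^sub>v n"
    using A(1) by (simp add: vnorm_eq_0_iff)
  then have "(A * inv_mat A) $$ (i, i) = 0"
    using A(1) inv(1) i by simp
  then show False using inv(2) i by simp
qed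

section \<open>One exact step\<close>

text \<open>Subtracting the component of the error along a row is an orthogonal projection, so Pythagoras
  gives the squared length, and the arithmetic-geometric mean inequality
  \<open>2 \<parallel>e\<parallel> \<parallel>Pe\<parallel> \<le> \<parallel>e\<parallel>\<^sup>2 + \<parallel>Pe\<parallel>\<^sup>2\<close> removes the square. Removing it here, before averaging over the rows,
  is what later replaces Jensen's inequality for the square root.\<close>

lemma vnorm_project_off_le:
  assumes a: "a \<in> carrier_vec n" and e: "e \<in> carrier_vec n"
    and apos: "0 < vnorm a" and epos: "0 < vnorm e"
  shows "vnorm (e - ((a \<bullet> e) / (vnorm a)\<^sup>2) \<cdot>\<^sub>v a)
     \<le> vnorm e - (a \<bullet> e)\<^sup>2 / (2 * (vnorm a)\<^sup>2 * vnorm e)"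
proof -
  let ?c = "(a \<bullet> e) / (vnorm a)\<^sup>2"
  let ?v = "vnorm (e - ?c \<cdot>\<^sub>v a)"
  have "(vnorm (e - c \<cdot>\<^sub>v a))\<^sup>2 = e \<bullet> e - 2 * c * (a \<bullet> e) + c\<^sup>2 * (a \<bullet> a)" for c
    unfolding vnorm_sq using a e comm_scalar_prod[OF e a]
    by (simp add: minus_scalar_prod_distrib[of _ n] scalar_prod_minus_distrib[of _ n]
        power2_eq_square algebra_simps)
  then have "?v\<^sup>2 = e \<bullet> e - 2 * ?c * (a \<bullet> e) + ?c\<^sup>2 * (a \<bullet> a)" .
  also have "\<dots> = (vnorm e)\<^sup>2 - (a \<bullet> e)\<^sup>2 / (vnorm a)\<^sup>2"
    using apos unfolding vnorm_sq[symmetric] by (simp add: field_simps power2_eq_square)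
  finally have v2: "?v\<^sup>2 = (vnorm e)\<^sup>2 - (a \<bullet> e)\<^sup>2 / (vnorm a)\<^sup>2" .
  have "0 \<le> (vnorm e - ?v)\<^sup>2" by simp
  then have "2 * vnorm e * ?v \<le> 2 * (vnorm e)\<^sup>2 - (a \<bullet> e)\<^sup>2 / (vnorm a)\<^sup>2"
    unfolding power2_diff v2 by (simp add: algebra_simps)
  then have "?v \<le> (2 * (vnorm e)\<^sup>2 - (a \<bullet> e)\<^sup>2 / (vnorm a)\<^sup>2) / (2 * vnorm e)"
    using epos by (simp add: pos_le_divide_eq mult.commute)
  also have "\<dots> = vnorm e - (a \<bullet> e)\<^sup>2 / (2 * (vnorm a)\<^sup>2 * vnorm e)"
    using epos apos by (simp add: field_simps power2_eq_square)
  finally show ?thesis .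
qed

text \<open>The sampling probability of a row cancels the normalisation of its projection, so the average of
  the gains \<open>\<langle>a\<^sub>i, e\<rangle>\<^sup>2 / \<parallel>a\<^sub>i\<parallel>\<^sup>2\<close> is \<open>\<parallel>A e\<parallel>\<^sup>2 / \<parallel>A\<parallel>\<^sub>F\<^sup>2\<close>, and this is at least
  \<open>\<parallel>e\<parallel>\<^sup>2\<close> divided by the squared condition number.\<close>

lemma expected_exact_step_le:
  assumes n: "1 \<le> n" and A: "A \<in> carrier_mat n n" "invertible_mat A" and e: "e \<in> carrier_vec n"
  shows "(\<Sum>i<n. (vnorm (row A i))\<^sup>2 / (frobenius_norm A)\<^sup>2 *
             vnorm (e - ((row A i \<bullet> e) / (vnorm (row A i))\<^sup>2) \<cdot>\<^sub>v row A i))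
     \<le> (1 - 1 / (2 * (demmel_cond A)\<^sup>2)) * vnorm e"
proof (cases "vnorm e = 0")
  case True
  have "e = 0\<^sub>v n"
    using True e by (simp add: vnorm_eq_0_iff)
  moreover have "0\<^sub>v n - ((row A i \<bullet> 0\<^sub>v n) / (vnorm (row A i))\<^sup>2) \<cdot>\<^sub>v row A i = 0\<^sub>v n" for i
    using A(1) by (intro eq_vecI) auto
  ultimately show ?thesis
    using True by simp
next
  case False
  then have epos: "0 < vnorm e" by (simp add: less_le)
  let ?f = "frobenius_norm A" and ?o = "opnorm (inv_mat A)"
  have "0 < ?f * ?o"
    using demmel_cond_ge_1[OF n A] unfolding demmel_cond_def by linarith
  then have fpos: "0 < ?f" and opos: "0 < ?o"
    using frobenius_norm_nonneg[of A] by (auto simp: zero_less_mult_iff)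
  have row_sum: "(\<Sum>i<n. (vnorm (row A i))\<^sup>2) = ?f\<^sup>2"
    using A(1) by (simp add: frobenius_norm_sq)
  have "(\<Sum>i<n. (vnorm (row A i))\<^sup>2 / ?f\<^sup>2 *
             vnorm (e - ((row A i \<bullet> e) / (vnorm (row A i))\<^sup>2) \<cdot>\<^sub>v row A i))
     \<le> (\<Sum>i<n. (vnorm (row A i))\<^sup>2 / ?f\<^sup>2 * vnorm e - (row A i \<bullet> e)\<^sup>2 / (2 * ?f\<^sup>2 * vnorm e))"
  proof (intro sum_mono)
    fix i assume "i \<in> {..<n}"
    then have a: "row A i \<in> carrier_vec n" "0 < vnorm (row A i)"
      using A(1) vnorm_row_pos[OF A] by auto
    have "(vnorm (row A i))\<^sup>2 / ?f\<^sup>2 *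
             vnorm (e - ((row A i \<bullet> e) / (vnorm (row A i))\<^sup>2) \<cdot>\<^sub>v row A i)
       \<le> (vnorm (row A i))\<^sup>2 / ?f\<^sup>2 *
          (vnorm e - (row A i \<bullet> e)\<^sup>2 / (2 * (vnorm (row A i))\<^sup>2 * vnorm e))"
      by (intro mult_left_mono vnorm_project_off_le[OF a(1) e a(2) epos]) simp
    also have "\<dots> = (vnorm (row A i))\<^sup>2 / ?f\<^sup>2 * vnorm e - (row A i \<bullet> e)\<^sup>2 / (2 * ?f\<^sup>2 * vnorm e)"
      using a(2) epos fpos by (simp add: field_simps)
    finally show "(vnorm (row A i))\<^sup>2 / ?f\<^sup>2 *
             vnorm (e - ((row A i \<bullet> e) / (vnorm (row A i))\<^sup>2) \<cdot>\<^sub>v row A i)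
       \<le> (vnorm (row A i))\<^sup>2 / ?f\<^sup>2 * vnorm e - (row A i \<bullet> e)\<^sup>2 / (2 * ?f\<^sup>2 * vnorm e)" .
  qed
  also have "\<dots> = vnorm e - (vnorm (A *\<^sub>v e))\<^sup>2 / (2 * ?f\<^sup>2 * vnorm e)"
    using A(1) fpos row_sum
    by (simp add: sum_subtractf vnorm_mult_mat_vec_sq
        flip: sum_divide_distrib sum_distrib_right)
  also have "\<dots> \<le> vnorm e - (vnorm e / ?o)\<^sup>2 / (2 * ?f\<^sup>2 * vnorm e)"
  proof -
    have "vnorm e / ?o \<le> vnorm (A *\<^sub>v e)"
      using vnorm_le_opnorm_inv_mat[OF A e] opos by (simp add: pos_divide_le_eq mult.commute)
    then have "(vnorm e / ?o)\<^sup>2 \<le> (vnorm (A *\<^sub>v e))\<^sup>2"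
      using opos by (intro power_mono) auto
    then show ?thesis
      using epos by (intro diff_left_mono divide_right_mono) auto
  qed
  also have "\<dots> = (1 - 1 / (2 * (demmel_cond A)\<^sup>2)) * vnorm e"
    using epos opos fpos by (simp add: demmel_cond_def field_simps power2_eq_square)
  finally show ?thesis .
qed

section \<open>Rounding errors of one step\<close>

lemma zero_in_floats:
  assumes "standard_fp_model u F"
  shows "0 \<in> floats F"
proof -
  have "fl F 0 \<in> floats F" "\<bar>fl F 0 - 0\<bar> \<le> u * \<bar>0\<bar>"
    using assms unfolding standard_fp_model_def by blast+
  then show ?thesis by simp
qed

lemma standard_fp_modelD:
  assumes "standard_fp_model u F" "a \<in> floats F" "b \<in> floats F"
  shows "fadd F a b \<in> floats F" "\<bar>fadd F a b - (a + b)\<bar> \<le> u * \<bar>a + b\<bar>"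
    "fsub F a b \<in> floats F" "\<bar>fsub F a b - (a - b)\<bar> \<le> u * \<bar>a - b\<bar>"
    "fmul F a b \<in> floats F" "\<bar>fmul F a b - (a * b)\<bar> \<le> u * \<bar>a * b\<bar>"
    "b \<noteq> 0 \<Longrightarrow> fdiv F a b \<in> floats F" "b \<noteq> 0 \<Longrightarrow> \<bar>fdiv F a b - (a / b)\<bar> \<le> u * \<bar>a / b\<bar>"
  using assms unfolding standard_fp_model_def by blast+

text \<open>A product enters with one rounding and is then carried through every later addition, so after
  \<open>m\<close> terms no contribution has met more than \<open>m + 1\<close> factors \<open>1 + u\<close>.\<close>

lemma fp_inner_partial_error:
  assumes fp: "standard_fp_model u F"
    and v: "\<And>i. i < m \<Longrightarrow> v $ i \<in> floats F" and w: "\<And>i. i < m \<Longrightarrow> w $ i \<in> floats F"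
  shows "foldl (\<lambda>s i. fadd F s (fmul F (v $ i) (w $ i))) 0 [0..<m] \<in> floats F \<and>
    \<bar>foldl (\<lambda>s i. fadd F s (fmul F (v $ i) (w $ i))) 0 [0..<m] - (\<Sum>i<m. v $ i * w $ i)\<bar>
     \<le> ((1 + u) ^ Suc m - 1) * (\<Sum>i<m. \<bar>v $ i * w $ i\<bar>)"
  using v w
proof (induction m)
  case 0
  then show ?case using zero_in_floats[OF fp] by simp
next
  case (Suc m)
  have u: "0 \<le> u" using fp by (simp add: standard_fp_model_def)
  define s where "s = foldl (\<lambda>s i. fadd F s (fmul F (v $ i) (w $ i))) 0 [0..<m]"
  define S where "S = (\<Sum>i<m. v $ i * w $ i)"
  define T where "T = (\<Sum>i<m. \<bar>v $ i * w $ i\<bar>)"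
  define p where "p = fmul F (v $ m) (w $ m)"
  define x where "x = v $ m * w $ m"
  define g where "g = (1 + u) ^ Suc m - 1"
  have s: "s \<in> floats F" "\<bar>s - S\<bar> \<le> g * T"
    using Suc by (simp_all add: s_def S_def T_def g_def)
  have p: "p \<in> floats F" "\<bar>p - x\<bar> \<le> u * \<bar>x\<bar>"
    using standard_fp_modelD(5,6)[OF fp] Suc.prems by (simp_all add: p_def x_def)
  note q = standard_fp_modelD(1,2)[OF fp s(1) p(1)]
  have ST: "\<bar>S\<bar> \<le> T" by (simp add: S_def T_def sum_abs)
  have g0: "u \<le> g"
    using power_increasing[of 1 "Suc m" "1 + u"] u by (simp add: g_def del: power_Suc)
  have "\<bar>fadd F s p - (S + x)\<bar> \<le> \<bar>fadd F s p - (s + p)\<bar> + \<bar>s + p - (S + x)\<bar>" by linarith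
  also have "\<dots> \<le> u * \<bar>s + p\<bar> + \<bar>s + p - (S + x)\<bar>" using q(2) by simp
  also have "\<dots> \<le> u * (\<bar>s + p - (S + x)\<bar> + (T + \<bar>x\<bar>)) + \<bar>s + p - (S + x)\<bar>"
    using u ST by (intro add_right_mono mult_left_mono) linarith+
  also have "\<dots> = (1 + u) * \<bar>s + p - (S + x)\<bar> + u * (T + \<bar>x\<bar>)"
    by (simp add: algebra_simps)
  also have "\<dots> \<le> (1 + u) * (g * T + u * \<bar>x\<bar>) + u * (T + \<bar>x\<bar>)"
    using u s(2) p(2) by (intro add_right_mono mult_left_mono) linarith+
  also have "\<dots> \<le> (1 + u) * (g * T + g * \<bar>x\<bar>) + u * (T + \<bar>x\<bar>)"
    using u g0 by (intro add_right_mono mult_left_mono add_left_mono mult_right_mono) auto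
  also have "\<dots> = ((1 + u) ^ Suc (Suc m) - 1) * (T + \<bar>x\<bar>)"
    by (simp add: g_def algebra_simps)
  finally show ?case
    using q(1) by (simp add: s_def S_def T_def x_def p_def)
qed

lemma one_plus_power_le:
  assumes "0 \<le> u" "real m * u \<le> 1"
  shows "(1 + u) ^ m - 1 \<le> 2 * real m * (u :: real)"
proof -
  have "(1 + u) ^ m \<le> exp u ^ m"
    using assms by (intro power_mono exp_ge_add_one_self) auto
  also have "\<dots> = exp (real m * u)" by (simp add: exp_of_nat_mult)
  also have "\<dots> \<le> 1 + real m * u + (real m * u)\<^sup>2"
    using assms by (intro exp_bound) auto
  also have "(real m * u)\<^sup>2 \<le> real m * u"
    using assms by (simp add: power2_eq_square mult_left_le)
  finally show ?thesis by (simp add: algebra_simps)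
qed

lemma fp_inner_error:
  assumes fp: "standard_fp_model u F" and n: "1 \<le> n" and u: "4 * real n * u \<le> 1"
    and v: "v \<in> carrier_vec n" "\<And>i. i < n \<Longrightarrow> v $ i \<in> floats F"
    and w: "w \<in> carrier_vec n" "\<And>i. i < n \<Longrightarrow> w $ i \<in> floats F"
  shows "fp_inner F v w \<in> floats F"
    and "\<bar>fp_inner F v w - v \<bullet> w\<bar> \<le> 4 * real n * u * (vnorm v * vnorm w)"
proof -
  have u0: "0 \<le> u" using fp by (simp add: standard_fp_model_def)
  have dim: "dim_vec v = n" "dim_vec w = n" using v(1) w(1) by auto
  note err = fp_inner_partial_error[OF fp, of n v w, OF v(2) w(2)]
  show "fp_inner F v w \<in> floats F"
    using err by (simp add: fp_inner_def dim)
  have nu: "u \<le> real n * u"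
    using n u0 mult_right_mono[of 1 "real n" u] by simp
  have "(1 + u) ^ Suc n - 1 \<le> 2 * real (Suc n) * u"
    using u0 u nu by (intro one_plus_power_le) (auto simp: algebra_simps)
  also have "\<dots> \<le> 4 * real n * u"
    using nu by (simp add: algebra_simps)
  finally have g: "(1 + u) ^ Suc n - 1 \<le> 4 * real n * u" .
  have "\<bar>fp_inner F v w - v \<bullet> w\<bar> \<le> ((1 + u) ^ Suc n - 1) * (\<Sum>i<n. \<bar>v $ i * w $ i\<bar>)"
    using err by (simp add: fp_inner_def dim scalar_prod_def lessThan_atLeast0)
  also have "\<dots> \<le> 4 * real n * u * (\<Sum>i<n. \<bar>v $ i * w $ i\<bar>)"
    using g by (intro mult_right_mono) (auto intro: sum_nonneg)
  also have "\<dots> \<le> 4 * real n * u * (vnorm v * vnorm w)"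
    using sum_abs_prod_le_vnorm[of v w] u0 by (intro mult_left_mono) (auto simp: dim)
  finally show "\<bar>fp_inner F v w - v \<bullet> w\<bar> \<le> 4 * real n * u * (vnorm v * vnorm w)" .
qed

text \<open>Here \<open>D\<close> stands for the residual and \<open>N\<close> for the norm of the row. In units of \<open>M / N\<close>, the perturbations of numerator and
  denominator contribute \<open>(3 + 1) \<gamma>\<close>, doubled because \<open>q\<close> may be as small as \<open>N\<^sup>2/2\<close>; the rounding of
  the division adds \<open>5 \<gamma>\<close>.\<close>

lemma rounded_quotient_error:
  fixes N M \<gamma> u D d q c :: real
  assumes N: "0 < N" and M: "0 \<le> M" and u: "0 \<le> u" "u \<le> \<gamma>" and \<gamma>: "\<gamma> \<le> 1/2"
    and D: "\<bar>D\<bar> \<le> N * M" and d: "\<bar>d - D\<bar> \<le> 3 * \<gamma> * (N * M)"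
    and q: "\<bar>q - N\<^sup>2\<bar> \<le> \<gamma> * N\<^sup>2" and c: "\<bar>c - d / q\<bar> \<le> u * \<bar>d / q\<bar>"
  shows "\<bar>c - D / N\<^sup>2\<bar> \<le> 13 * \<gamma> * (M / N)" and "\<bar>c\<bar> \<le> 8 * (M / N)"
proof -
  have \<gamma>0: "0 \<le> \<gamma>" using u by simp
  have N2: "0 < N\<^sup>2" using N by simp
  have "\<gamma> * N\<^sup>2 \<le> 1/2 * N\<^sup>2" using \<gamma> by (intro mult_right_mono) auto
  then have qlow: "N\<^sup>2 / 2 \<le> q" using q by linarith
  then have qpos: "0 < q" using N2 by linarith
  have MN: "0 \<le> M / N" using M N by simp
  have "d / q - D / N\<^sup>2 = ((d - D) - (D / N\<^sup>2) * (q - N\<^sup>2)) / q"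
    using qpos N2 by (simp add: field_simps)
  then have "\<bar>d / q - D / N\<^sup>2\<bar> = \<bar>(d - D) - (D / N\<^sup>2) * (q - N\<^sup>2)\<bar> / q"
    using qpos by (simp add: abs_divide)
  also have "\<dots> \<le> (4 * \<gamma> * (N * M)) / (N\<^sup>2 / 2)"
  proof (intro frac_le)
    have "\<bar>(D / N\<^sup>2) * (q - N\<^sup>2)\<bar> \<le> (N * M / N\<^sup>2) * (\<gamma> * N\<^sup>2)"
      unfolding abs_mult using D q N2 N M
      by (intro mult_mono) (auto simp: abs_divide divide_right_mono)
    also have "\<dots> = \<gamma> * (N * M)" using N by (simp add: power2_eq_square)
    finally have "\<bar>(D / N\<^sup>2) * (q - N\<^sup>2)\<bar> \<le> \<gamma> * (N * M)" .
    then show "\<bar>(d - D) - (D / N\<^sup>2) * (q - N\<^sup>2)\<bar> \<le> 4 * \<gamma> * (N * M)"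
      using d by linarith
  qed (use N2 qlow \<gamma>0 M N in auto)
  also have "\<dots> = 8 * (\<gamma> * (M / N))" using N by (simp add: field_simps power2_eq_square)
  finally have dq: "\<bar>d / q - D / N\<^sup>2\<bar> \<le> 8 * (\<gamma> * (M / N))" .
  have "\<bar>D / N\<^sup>2\<bar> \<le> (N * M) / N\<^sup>2"
    using D by (simp add: abs_divide divide_right_mono)
  then have DN: "\<bar>D / N\<^sup>2\<bar> \<le> M / N" using N by (simp add: power2_eq_square)
  have gMN: "\<gamma> * (M / N) \<le> 1/2 * (M / N)" using \<gamma> MN by (intro mult_right_mono)
  have "\<bar>d / q\<bar> \<le> 5 * (M / N)" using dq DN gMN by linarith
  then have "u * \<bar>d / q\<bar> \<le> \<gamma> * (5 * (M / N))"
    using u \<gamma>0 by (intro mult_mono) auto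
  then have "u * \<bar>d / q\<bar> \<le> 5 * (\<gamma> * (M / N))" by (simp only: mult.left_commute[of \<gamma> 5])
  then have main: "\<bar>c - D / N\<^sup>2\<bar> \<le> 13 * (\<gamma> * (M / N))" using c dq by linarith
  then show "\<bar>c - D / N\<^sup>2\<bar> \<le> 13 * \<gamma> * (M / N)" by simp
  show "\<bar>c\<bar> \<le> 8 * (M / N)" using main DN gMN MN by linarith
qed

text \<open>The residual \<open>\<langle>a, x - y\<rangle>\<close> may be much smaller than the computed inner product it is a difference
  of, so its rounding error can only be measured against \<open>\<parallel>a\<parallel> (\<parallel>x\<parallel> + \<parallel>y\<parallel>)\<close>. The division by
  \<open>\<parallel>a\<parallel>\<^sup>2\<close> and the multiplication by \<open>a\<close> cancel the scale of \<open>a\<close>, which leaves an absolute error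
  of a polynomial in \<open>n\<close> times \<open>u (\<parallel>x\<parallel> + \<parallel>y\<parallel>)\<close>.\<close>

lemma fp_kaczmarz_step_error:
  assumes fp: "standard_fp_model u F" and n: "1 \<le> n" and nu: "8 * real n * u \<le> 1"
    and A: "A \<in> carrier_mat n n" and i: "i < n" and apos: "0 < vnorm (row A i)"
    and Afl: "\<And>j. j < n \<Longrightarrow> A $$ (i, j) \<in> floats F"
    and x: "x \<in> carrier_vec n" and bi: "b $ i = row A i \<bullet> x" and bfl: "b $ i \<in> floats F"
    and y: "y \<in> carrier_vec n" and yfl: "\<And>j. j < n \<Longrightarrow> y $ j \<in> floats F"
  shows "fp_kaczmarz_step F A b i y \<in> carrier_vec n"
    and "\<And>j. j < n \<Longrightarrow> fp_kaczmarz_step F A b i y $ j \<in> floats F"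
    and "vnorm (fp_kaczmarz_step F A b i y
           - (y + ((row A i \<bullet> x - row A i \<bullet> y) / (vnorm (row A i))\<^sup>2) \<cdot>\<^sub>v row A i))
         \<le> 136 * (real n)\<^sup>2 * u * (vnorm x + vnorm y)"
proof -
  define a where "a = row A i"
  define \<gamma> where "\<gamma> = 4 * real n * u"
  define N where "N = vnorm a"
  define M where "M = vnorm x + vnorm y"
  define s where "s = fp_inner F a y"
  define q where "q = fp_inner F a a"
  define d where "d = fsub F (b $ i) s"
  define c where "c = fdiv F d q"
  define D where "D = a \<bullet> x - a \<bullet> y"
  have u0: "0 \<le> u" using fp by (simp add: standard_fp_model_def)
  have a: "a \<in> carrier_vec n" "\<And>j. j < n \<Longrightarrow> a $ j \<in> floats F"
    using A i Afl by (auto simp: a_def)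
  have dim: "dim_vec a = n" "dim_vec x = n" "dim_vec y = n" using a(1) x y by auto
  have \<gamma>: "\<gamma> \<le> 1/2" "4 * real n * u \<le> 1" using nu u0 by (auto simp: \<gamma>_def)
  have u\<gamma>: "u \<le> \<gamma>"
    using n u0 mult_right_mono[of 1 "4 * real n" u] by (simp add: \<gamma>_def)
  have N: "0 < N" using apos by (simp add: N_def a_def)
  have M: "0 \<le> M" "vnorm x \<le> M" "vnorm y \<le> M" by (auto simp: M_def)
  have s: "s \<in> floats F" "\<bar>s - a \<bullet> y\<bar> \<le> \<gamma> * (N * vnorm y)"
    using fp_inner_error[OF fp n \<gamma>(2) a y yfl] by (auto simp: s_def \<gamma>_def N_def)
  have q: "q \<in> floats F" "\<bar>q - N\<^sup>2\<bar> \<le> \<gamma> * N\<^sup>2"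
    using fp_inner_error[OF fp n \<gamma>(2) a a]
    by (auto simp: q_def \<gamma>_def N_def vnorm_sq[symmetric] power2_eq_square)
  have "\<gamma> * N\<^sup>2 \<le> 1/2 * N\<^sup>2" using \<gamma>(1) by (intro mult_right_mono) auto
  moreover have "0 < N\<^sup>2" using N by simp
  ultimately have q0: "q \<noteq> 0" using q(2) by auto
  have d: "d \<in> floats F" "\<bar>d - (b $ i - s)\<bar> \<le> u * \<bar>b $ i - s\<bar>"
    using standard_fp_modelD(3,4)[OF fp bfl s(1)] by (auto simp: d_def)
  have c: "c \<in> floats F" "\<bar>c - d / q\<bar> \<le> u * \<bar>d / q\<bar>"
    using standard_fp_modelD(7,8)[OF fp d(1) q(1)] q0 by (auto simp: c_def)
  have ax: "\<bar>a \<bullet> x\<bar> \<le> N * vnorm x" and ay: "\<bar>a \<bullet> y\<bar> \<le> N * vnorm y"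
    using abs_scalar_prod_le_vnorm[of a x] abs_scalar_prod_le_vnorm[of a y] dim
    by (auto simp: N_def)
  have NM: "N * vnorm x + N * vnorm y = N * M" by (simp add: M_def algebra_simps)
  have Ny: "0 \<le> N * vnorm y" "N * vnorm y \<le> N * M" using N M by auto
  have D: "\<bar>D\<bar> \<le> N * M" using ax ay NM by (simp add: D_def)
  have s': "\<bar>s - a \<bullet> y\<bar> \<le> \<gamma> * (N * M)"
    using s(2) mult_left_mono[OF Ny(2), of \<gamma>] u0 u\<gamma> by linarith
  have "\<gamma> * (N * M) \<le> N * M" using \<gamma>(1) N M(1) by (simp add: mult_left_le_one_le u0 u\<gamma> order_trans[OF u0 u\<gamma>])
  then have bs: "\<bar>b $ i - s\<bar> \<le> 2 * (N * M)"
    using s' D by (simp add: bi a_def[symmetric] D_def)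
  have "u * \<bar>b $ i - s\<bar> \<le> \<gamma> * (2 * (N * M))"
    using u0 u\<gamma> bs by (intro mult_mono) auto
  then have dD: "\<bar>d - D\<bar> \<le> 3 * \<gamma> * (N * M)"
    using d(2) s' unfolding D_def bi a_def[symmetric] by linarith
  note cc = rounded_quotient_error[OF N M(1) u0 u\<gamma> \<gamma>(1) D dD q(2) c(2)]
  have step: "fp_kaczmarz_step F A b i y = vec n (\<lambda>j. fadd F (y $ j) (fmul F c (a $ j)))"
    by (auto simp: fp_kaczmarz_step_def Let_def fp_vec_add_def fp_scale_def c_def d_def q_def s_def
        a_def[symmetric] dim intro!: eq_vecI)
  have t: "fmul F c (a $ j) \<in> floats F" "\<bar>fmul F c (a $ j) - c * a $ j\<bar> \<le> u * \<bar>c * a $ j\<bar>"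
    if "j < n" for j
    using standard_fp_modelD(5,6)[OF fp c(1) a(2)[OF that]] .
  show "fp_kaczmarz_step F A b i y \<in> carrier_vec n" by (simp add: step)
  show "fp_kaczmarz_step F A b i y $ j \<in> floats F" if "j < n" for j
    using standard_fp_modelD(1)[OF fp yfl[OF that] t(1)[OF that]] that by (simp add: step)
  let ?r = "fp_kaczmarz_step F A b i y - (y + (D / N\<^sup>2) \<cdot>\<^sub>v a)"
  \<comment> \<open>\<open>34 = 13 + 8 + 13\<close>: error of the coefficient, rounding of the product, rounding of the sum.\<close>
  have "\<bar>?r $ j\<bar> \<le> 34 * \<gamma> * M" if "j < dim_vec ?r" for j
  proof -
    have j: "j < n" using that by (simp add: step dim)
    have aj: "\<bar>a $ j\<bar> \<le> N" using abs_index_le_vnorm[of j a] j dim by (simp add: N_def)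
    have yj: "\<bar>y $ j\<bar> \<le> M" using abs_index_le_vnorm[of j y] j dim M(3) by simp
    have "\<bar>c * a $ j\<bar> \<le> 8 * (M / N) * N"
      unfolding abs_mult using cc(2) aj M(1) N by (intro mult_mono) auto
    then have ca: "\<bar>c * a $ j\<bar> \<le> 8 * M" using N by simp
    have "\<bar>(c - D / N\<^sup>2) * a $ j\<bar> \<le> 13 * \<gamma> * (M / N) * N"
      unfolding abs_mult using cc(1) aj M(1) N u0 u\<gamma> by (intro mult_mono) auto
    then have cDa: "\<bar>c * a $ j - D / N\<^sup>2 * a $ j\<bar> \<le> 13 * (\<gamma> * M)"
      using N by (simp add: algebra_simps)
    have "u * \<bar>c * a $ j\<bar> \<le> \<gamma> * (8 * M)" using u0 u\<gamma> ca by (intro mult_mono) auto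
    then have tt: "\<bar>fmul F c (a $ j) - c * a $ j\<bar> \<le> 8 * (\<gamma> * M)"
      using t(2)[OF j] by linarith
    have gM: "\<gamma> * M \<le> 1/2 * M" using \<gamma>(1) M(1) by (intro mult_right_mono)
    have "\<bar>y $ j + fmul F c (a $ j)\<bar> \<le> 13 * M" using yj ca tt gM M(1) by linarith
    then have "u * \<bar>y $ j + fmul F c (a $ j)\<bar> \<le> \<gamma> * (13 * M)"
      using u0 u\<gamma> by (intro mult_mono) auto
    then have "\<bar>fadd F (y $ j) (fmul F c (a $ j)) - (y $ j + fmul F c (a $ j))\<bar> \<le> 13 * (\<gamma> * M)"
      using standard_fp_modelD(2)[OF fp yfl[OF j] t(1)[OF j]] by linarith
    then have "\<bar>fadd F (y $ j) (fmul F c (a $ j)) - (y $ j + D / N\<^sup>2 * a $ j)\<bar> \<le> 34 * (\<gamma> * M)"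
      using tt cDa by linarith
    then show ?thesis using j by (simp add: step dim)
  qed
  then have "vnorm ?r \<le> real (dim_vec ?r) * (34 * \<gamma> * M)"
    by (rule vnorm_le_dim_mult)
  also have "\<dots> = 136 * (real n)\<^sup>2 * u * M"
    by (simp add: dim \<gamma>_def power2_eq_square)
  finally show "vnorm (fp_kaczmarz_step F A b i y
           - (y + ((row A i \<bullet> x - row A i \<bullet> y) / (vnorm (row A i))\<^sup>2) \<cdot>\<^sub>v row A i))
         \<le> 136 * (real n)\<^sup>2 * u * (vnorm x + vnorm y)"
    by (simp add: D_def N_def a_def M_def)
qed

section \<open>Expectation over the random rows\<close>

lemma set_pmf_row_pmf:
  assumes "frobenius_norm A \<noteq> 0"
  shows "set_pmf (row_pmf A) \<subseteq> {..<dim_row A}"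
  using assms by (auto simp: set_pmf_eq pmf_row_pmf split: if_splits)

abbreviation row_sequence_pmf :: "real mat \<Rightarrow> nat \<Rightarrow> (nat \<Rightarrow> nat) pmf" where
  "row_sequence_pmf A k \<equiv> Pi_pmf {..<k} 0 (\<lambda>_. row_pmf A)"

lemma finite_row_sequence_pmf:
  assumes "frobenius_norm A \<noteq> 0"
  shows "finite (set_pmf (row_sequence_pmf A k))"
  using finite_subset[OF set_pmf_row_pmf[OF assms]]
  by (subst set_Pi_pmf) (auto intro!: finite_PiE_dflt)

lemma expectation_mono_finite_support:
  fixes f g :: "'a \<Rightarrow> real"
  assumes "finite (set_pmf p)" "\<And>y. y \<in> set_pmf p \<Longrightarrow> f y \<le> g y"
  shows "measure_pmf.expectation p f \<le> measure_pmf.expectation p g"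
  using assms
  by (intro integral_mono_AE integrable_measure_pmf_finite) (auto simp: AE_measure_pmf_iff)

lemma fp_kaczmarz_cong:
  assumes "\<And>j. j < k \<Longrightarrow> r j = r' j"
  shows "fp_kaczmarz F A b x0 r k = fp_kaczmarz F A b x0 r' k"
  using assms by (induction k) auto

text \<open>The \<open>k\<close>-th iterate does not see the draw \<open>r k\<close>, so that draw can be averaged with the past held
  fixed.\<close>

lemma expected_error_Suc:
  assumes f: "frobenius_norm A \<noteq> 0"
  shows "expected_error F A b x0 x (Suc k) =
    measure_pmf.expectation (row_sequence_pmf A k)
      (\<lambda>r. \<Sum>i<dim_row A. (vnorm (row A i))\<^sup>2 / (frobenius_norm A)\<^sup>2 *
             vnorm (fp_kaczmarz_step F A b i (fp_kaczmarz F A b x0 r k) - x))"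
proof -
  let ?P = "row_sequence_pmf A k"
  note fin = finite_row_sequence_pmf[OF f, of k]
  have "row_sequence_pmf A (Suc k) = row_pmf A \<bind> (\<lambda>i. map_pmf (\<lambda>r. r(k := i)) ?P)"
    unfolding lessThan_Suc by (subst Pi_pmf_insert') (auto simp: map_pmf_def)
  then have "expected_error F A b x0 x (Suc k) =
      (\<Sum>i<dim_row A. pmf (row_pmf A) i *\<^sub>R measure_pmf.expectation (map_pmf (\<lambda>r. r(k := i)) ?P)
         (\<lambda>r. vnorm (fp_kaczmarz F A b x0 r (Suc k) - x)))"
    unfolding expected_error_def using fin set_pmf_row_pmf[OF f]
    by (subst pmf_expectation_bind[of "{..<dim_row A}", symmetric]) auto
  also have "\<dots> = (\<Sum>i<dim_row A. measure_pmf.expectation ?P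
      (\<lambda>r. (vnorm (row A i))\<^sup>2 / (frobenius_norm A)\<^sup>2 *
             vnorm (fp_kaczmarz_step F A b i (fp_kaczmarz F A b x0 r k) - x)))"
  proof (intro sum.cong refl)
    fix i assume i: "i \<in> {..<dim_row A}"
    have "fp_kaczmarz F A b x0 (r(k := i)) k = fp_kaczmarz F A b x0 r k" for r
      by (rule fp_kaczmarz_cong) auto
    then show "pmf (row_pmf A) i *\<^sub>R measure_pmf.expectation (map_pmf (\<lambda>r. r(k := i)) ?P)
         (\<lambda>r. vnorm (fp_kaczmarz F A b x0 r (Suc k) - x)) =
      measure_pmf.expectation ?P
      (\<lambda>r. (vnorm (row A i))\<^sup>2 / (frobenius_norm A)\<^sup>2 *
             vnorm (fp_kaczmarz_step F A b i (fp_kaczmarz F A b x0 r k) - x))"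
      using i f by (simp add: pmf_row_pmf)
  qed
  also have "\<dots> = measure_pmf.expectation ?P
      (\<lambda>r. \<Sum>i<dim_row A. (vnorm (row A i))\<^sup>2 / (frobenius_norm A)\<^sup>2 *
             vnorm (fp_kaczmarz_step F A b i (fp_kaczmarz F A b x0 r k) - x))"
    by (intro Bochner_Integration.integral_sum[symmetric] integrable_measure_pmf_finite fin)
  finally show ?thesis .
qed

text \<open>The error bounds of the arithmetic apply to representable operands, so representability has to be
  carried along the iteration.\<close>

lemma fp_kaczmarz_closed:
  assumes fp: "standard_fp_model u F" and n: "1 \<le> n" and nu: "8 * real n * u \<le> 1"
    and A: "A \<in> carrier_mat n n" "invertible_mat A"
    and Afl: "\<And>i j. i < n \<Longrightarrow> j < n \<Longrightarrow> A $$ (i, j) \<in> floats F"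
    and x: "x \<in> carrier_vec n" and bx: "\<And>i. i < n \<Longrightarrow> b $ i = row A i \<bullet> x"
    and bfl: "\<And>i. i < n \<Longrightarrow> b $ i \<in> floats F"
    and x0: "x0 \<in> carrier_vec n" "\<And>j. j < n \<Longrightarrow> x0 $ j \<in> floats F"
    and r: "\<And>j. j < k \<Longrightarrow> r j < n"
  shows "fp_kaczmarz F A b x0 r k \<in> carrier_vec n \<and>
    (\<forall>j<n. fp_kaczmarz F A b x0 r k $ j \<in> floats F)"
  using r
proof (induction k)
  case 0
  then show ?case using x0 by simp
next
  case (Suc k)
  then have y: "fp_kaczmarz F A b x0 r k \<in> carrier_vec n"
      "\<And>j. j < n \<Longrightarrow> fp_kaczmarz F A b x0 r k $ j \<in> floats F" and i: "r k < n"
    by auto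
  show ?case
    using fp_kaczmarz_step_error(1,2)[OF fp n nu A(1) i vnorm_row_pos[OF A i] Afl[OF i]
        x bx[OF i] bfl[OF i] y] by simp
qed

text \<open>A rounded step is an exact step followed by an error of size \<open>O(n\<^sup>2 u) (\<parallel>x\<parallel> + \<parallel>y\<parallel>)\<close>, and
  \<open>\<parallel>y\<parallel> \<le> \<parallel>x\<parallel> + \<parallel>y - x\<parallel>\<close> expresses it through the current error.\<close>

lemma expected_rounded_step_le:
  assumes fp: "standard_fp_model u F" and n: "1 \<le> n" and nu: "8 * real n * u \<le> 1"
    and A: "A \<in> carrier_mat n n" "invertible_mat A"
    and Afl: "\<And>i j. i < n \<Longrightarrow> j < n \<Longrightarrow> A $$ (i, j) \<in> floats F"
    and x: "x \<in> carrier_vec n" and bx: "\<And>i. i < n \<Longrightarrow> b $ i = row A i \<bullet> x"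
    and bfl: "\<And>i. i < n \<Longrightarrow> b $ i \<in> floats F"
    and y: "y \<in> carrier_vec n" "\<And>j. j < n \<Longrightarrow> y $ j \<in> floats F"
    and f: "frobenius_norm A \<noteq> 0"
  shows "(\<Sum>i<n. (vnorm (row A i))\<^sup>2 / (frobenius_norm A)\<^sup>2 *
             vnorm (fp_kaczmarz_step F A b i y - x))
     \<le> (1 - 1 / (2 * (demmel_cond A)\<^sup>2)) * vnorm (y - x)
        + 272 * (real n)\<^sup>2 * u * (vnorm x + vnorm (y - x))"
proof -
  let ?w = "\<lambda>i. (vnorm (row A i))\<^sup>2 / (frobenius_norm A)\<^sup>2"
  let ?e = "y - x"
  let ?P = "\<lambda>i. ?e - ((row A i \<bullet> ?e) / (vnorm (row A i))\<^sup>2) \<cdot>\<^sub>v row A i"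
  let ?\<delta> = "272 * (real n)\<^sup>2 * u * (vnorm x + vnorm ?e)"
  have u0: "0 \<le> u" using fp by (simp add: standard_fp_model_def)
  have "y = x + ?e" using x y by (intro eq_vecI) auto
  then have "vnorm y \<le> vnorm x + vnorm ?e"
    using vnorm_add_le[of x n ?e] x y(1) by simp
  then have vy: "vnorm x + vnorm y \<le> 2 * (vnorm x + vnorm ?e)"
    using vnorm_nonneg[of ?e] by argo
  have step: "vnorm (fp_kaczmarz_step F A b i y - x) \<le> vnorm (?P i) + ?\<delta>" if i: "i < n" for i
  proof -
    note se = fp_kaczmarz_step_error[OF fp n nu A(1) i vnorm_row_pos[OF A i] Afl[OF i]
        x bx[OF i] bfl[OF i] y]
    let ?s = "fp_kaczmarz_step F A b i y"
    let ?c = "(row A i \<bullet> x - row A i \<bullet> y) / (vnorm (row A i))\<^sup>2"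
    let ?z = "y + ?c \<cdot>\<^sub>v row A i"
    have a: "row A i \<in> carrier_vec n" using A(1) i by simp
    have "y + (- g) \<cdot>\<^sub>v row A i - x = ?e - g \<cdot>\<^sub>v row A i" for g
      using A(1) x y(1) by (intro eq_vecI) auto
    moreover have "?c = - ((row A i \<bullet> ?e) / (vnorm (row A i))\<^sup>2)"
      using a x y(1) by (simp add: scalar_prod_minus_distrib[of _ n] minus_divide_left del: divide_minus_left)
    ultimately have zP: "?z - x = ?P i" by simp
    have split: "?s - x = (?s - z) + (z - x)" if "z \<in> carrier_vec n" for z
      using x se(1) that by (intro eq_vecI) auto
    have "?s - x = (?s - ?z) + ?P i"
      unfolding zP[symmetric] by (rule split) (use a y(1) in simp)
    then have "vnorm (?s - x) \<le> vnorm (?s - ?z) + vnorm (?P i)"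
      using vnorm_add_le[of "?s - ?z" n "?P i"] a x y(1) se(1) by simp
    also have "vnorm (?s - ?z) \<le> 136 * (real n)\<^sup>2 * u * (vnorm x + vnorm y)"
      by (rule se(3))
    also have "\<dots> \<le> 136 * (real n)\<^sup>2 * u * (2 * (vnorm x + vnorm ?e))"
      using vy u0 by (intro mult_left_mono) auto
    also have "\<dots> = ?\<delta>" by simp
    finally show ?thesis by linarith
  qed
  have "(\<Sum>i<n. ?w i * vnorm (fp_kaczmarz_step F A b i y - x))
     \<le> (\<Sum>i<n. ?w i * (vnorm (?P i) + ?\<delta>))"
    using step by (intro sum_mono mult_left_mono) auto
  also have "\<dots> = (\<Sum>i<n. ?w i * vnorm (?P i)) + (\<Sum>i<n. ?w i) * ?\<delta>"
    by (simp only: distrib_left sum.distrib sum_distrib_right)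
  also have "(\<Sum>i<n. ?w i) = (frobenius_norm A)\<^sup>2 / (frobenius_norm A)\<^sup>2"
    unfolding frobenius_norm_sq[of A] sum_divide_distrib[symmetric] using A(1) by simp
  also have "\<dots> = 1" using f by simp
  also have "(\<Sum>i<n. ?w i * vnorm (?P i)) \<le> (1 - 1 / (2 * (demmel_cond A)\<^sup>2)) * vnorm ?e"
    using x y(1) by (intro expected_exact_step_le n A) auto
  finally show ?thesis by simp
qed

lemma expected_error_Suc_le:
  assumes fp: "standard_fp_model u F" and n: "1 \<le> n" and nu: "8 * real n * u \<le> 1"
    and A: "A \<in> carrier_mat n n" "invertible_mat A"
    and Afl: "\<And>i j. i < n \<Longrightarrow> j < n \<Longrightarrow> A $$ (i, j) \<in> floats F"
    and x: "x \<in> carrier_vec n" and bx: "\<And>i. i < n \<Longrightarrow> b $ i = row A i \<bullet> x"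
    and bfl: "\<And>i. i < n \<Longrightarrow> b $ i \<in> floats F"
    and x0: "x0 \<in> carrier_vec n" "\<And>j. j < n \<Longrightarrow> x0 $ j \<in> floats F"
  shows "expected_error F A b x0 x (Suc k)
     \<le> (1 - 1 / (2 * (demmel_cond A)\<^sup>2)) * expected_error F A b x0 x k
        + 272 * (real n)\<^sup>2 * u * (vnorm x + expected_error F A b x0 x k)"
proof -
  let ?p = "row_sequence_pmf A k"
  let ?\<rho> = "1 - 1 / (2 * (demmel_cond A)\<^sup>2)" and ?c = "272 * (real n)\<^sup>2 * u"
  let ?e = "\<lambda>r. vnorm (fp_kaczmarz F A b x0 r k - x)"
  have f: "frobenius_norm A \<noteq> 0"
    using demmel_cond_ge_1[OF n A] by (auto simp: demmel_cond_def)
  note fin = finite_row_sequence_pmf[OF f, of k]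
  note int = integrable_measure_pmf_finite[OF fin]
  have "expected_error F A b x0 x (Suc k) \<le>
     measure_pmf.expectation ?p (\<lambda>r. ?\<rho> * ?e r + ?c * (vnorm x + ?e r))"
    unfolding expected_error_Suc[OF f]
  proof (rule expectation_mono_finite_support[OF fin])
    fix r assume "r \<in> set_pmf ?p"
    then have "r j < n" if "j < k" for j
      using that set_pmf_row_pmf[OF f] A(1) by (auto simp: set_Pi_pmf PiE_dflt_def)
    then have y: "fp_kaczmarz F A b x0 r k \<in> carrier_vec n"
      "\<And>j. j < n \<Longrightarrow> fp_kaczmarz F A b x0 r k $ j \<in> floats F"
      using fp_kaczmarz_closed[OF fp n nu A Afl x bx bfl x0, of k r] by auto
    show "(\<Sum>i<dim_row A. (vnorm (row A i))\<^sup>2 / (frobenius_norm A)\<^sup>2 *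
             vnorm (fp_kaczmarz_step F A b i (fp_kaczmarz F A b x0 r k) - x))
        \<le> ?\<rho> * ?e r + ?c * (vnorm x + ?e r)"
      using expected_rounded_step_le[OF fp n nu A Afl x bx bfl y f] A(1) by simp
  qed
  also have "\<dots> = ?\<rho> * measure_pmf.expectation ?p ?e
      + ?c * (vnorm x + measure_pmf.expectation ?p ?e)"
    by (simp add: int)
  finally show ?thesis by (simp add: expected_error_def)
qed

section \<open>Accumulation of the error\<close>

text \<open>The term \<open>c E\<^sub>k\<close> would spoil the rate \<open>1 - 1/(2t)\<close> if it were absorbed into the contraction.
  Instead, a first induction shows that \<open>E\<^sub>k\<close> never exceeds \<open>3 X\<close>; the term is then a constant
  forcing \<open>c \<cdot> 3 X\<close>, whose geometric series sums to a multiple of \<open>t c X\<close> at the unchanged rate.\<close>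

lemma perturbed_contraction_bound:
  fixes E :: "nat \<Rightarrow> real"
  assumes t: "1 \<le> t" and c: "0 \<le> c" "c * t \<le> 3/8" and X: "0 \<le> X" and E0: "E 0 \<le> 2 * X"
    and step: "\<And>k. E (Suc k) \<le> (1 - 1 / (2 * t)) * E k + c * (X + E k)"
  shows "E k \<le> (1 - 1 / (2 * t)) ^ k * E 0 + 8 * c * t * X"
proof -
  define \<rho> where "\<rho> = 1 - 1 / (2 * t)"
  have \<rho>: "0 \<le> \<rho>" using t by (simp add: \<rho>_def)
  have "4 * c \<le> 3 / (2 * t)" using c(2) t by (simp add: field_simps)
  then have gain: "3 * \<rho> + 4 * c \<le> 3" by (simp add: \<rho>_def)
  have E3: "E k \<le> 3 * X" for k
  proof (induction k)
    case 0
    then show ?case using E0 X by simp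
  next
    case (Suc k)
    have "E (Suc k) \<le> \<rho> * E k + c * (X + E k)" using step by (simp add: \<rho>_def)
    also have "\<dots> \<le> \<rho> * (3 * X) + c * (X + 3 * X)"
      using Suc \<rho> c(1) by (intro add_mono mult_left_mono) auto
    also have "\<dots> = (3 * \<rho> + 4 * c) * X" by (simp add: algebra_simps)
    also have "\<dots> \<le> 3 * X" using gain X by (rule mult_right_mono)
    finally show ?case .
  qed
  have "E k \<le> \<rho> ^ k * E 0 + 8 * c * t * X"
  proof (induction k)
    case 0
    then show ?case using c t X by simp
  next
    case (Suc k)
    have "E (Suc k) \<le> \<rho> * E k + c * (X + E k)" using step by (simp add: \<rho>_def)
    also have "\<dots> \<le> \<rho> * (\<rho> ^ k * E 0 + 8 * c * t * X) + c * (X + 3 * X)"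
      using Suc E3 \<rho> c(1) by (intro add_mono mult_left_mono) auto
    also have "\<dots> = \<rho> ^ Suc k * E 0 + (8 * c * t * \<rho> + 4 * c) * X" by (simp add: algebra_simps)
    also have "8 * c * t * \<rho> + 4 * c = 8 * c * t"
      using t by (simp add: \<rho>_def field_simps)
    finally show ?case .
  qed
  then show ?thesis by (simp add: \<rho>_def)
qed

lemma contraction_power_le_roundoff:
  fixes t u :: real
  assumes t: "1 \<le> t" and u: "0 < u" and m: "2 * t * ln (1 / u) \<le> real m"
  shows "(1 - 1 / (2 * t)) ^ m \<le> u"
proof -
  have "(1 - 1 / (2 * t)) ^ m \<le> exp (- (1 / (2 * t))) ^ m"
    using t exp_ge_add_one_self[of "- (1 / (2 * t))"] by (intro power_mono) auto
  also have "\<dots> = exp (- (real m / (2 * t)))"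
    by (simp flip: exp_of_nat_mult)
  also have "\<dots> \<le> exp (- ln (1 / u))"
    using m t by (simp add: field_simps)
  also have "\<dots> = u" using u by (simp add: ln_div)
  finally show ?thesis .
qed

theorem theorem1p1:
  shows "\<exists>(C\<^sub>0 :: real poly) (C :: real poly) (C\<^sub>1 :: real poly) (K :: real) (N :: real \<Rightarrow> real \<Rightarrow> nat).
    (\<forall>n\<ge>1::nat. poly C\<^sub>0 (real n) > 0 \<and> poly C (real n) > 0 \<and> poly C\<^sub>1 (real n) > 0) \<and> K > 0 \<and>
    (\<forall>(n::nat) (A :: real mat) (b :: real vec) (x :: real vec) (x0 :: real vec) (u :: real) (F :: fp_arith).
       n \<ge> 1 \<longrightarrow> A \<in> carrier_mat n n \<longrightarrow> invertible_mat A \<longrightarrow>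
       b \<in> carrier_vec n \<longrightarrow> x = inv_mat A *\<^sub>v b \<longrightarrow> x0 \<in> carrier_vec n \<longrightarrow>
       standard_fp_model u F \<longrightarrow>
       (\<forall>i<n. \<forall>j<n. A $$ (i, j) \<in> floats F) \<longrightarrow>
       (\<forall>i<n. b $ i \<in> floats F) \<longrightarrow> (\<forall>i<n. x0 $ i \<in> floats F) \<longrightarrow>
       vnorm x0 \<le> vnorm x \<longrightarrow>
       (demmel_cond A)\<^sup>2 * u \<le> 1 / poly C\<^sub>0 (real n) \<longrightarrow>
       (\<forall>k. expected_error F A b x0 x k
              \<le> (1 - 1 / (2 * (demmel_cond A)\<^sup>2)) ^ k * vnorm (x0 - x)
                + poly C (real n) * vnorm x * (demmel_cond A)\<^sup>2 * u) \<and>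
       (0 < u \<longrightarrow>
          real (N (demmel_cond A) u) \<le> K * (demmel_cond A)\<^sup>2 * ln (1 / u) \<and>
          expected_error F A b x0 x (N (demmel_cond A) u)
            \<le> poly C\<^sub>1 (real n) * vnorm x * (demmel_cond A)\<^sup>2 * u))"
proof -
  \<comment> \<open>With the one-step error constant \<open>c = 272 n\<^sup>2 u\<close>, the choice of \<open>C\<^sub>0\<close> gives \<open>c \<kappa>\<^sup>2 \<le> 272/1024 \<le> 3/8\<close>,
    and \<open>C\<close> is the resulting \<open>8 c \<kappa>\<^sup>2 / (\<kappa>\<^sup>2 u)\<close>. In \<open>C\<^sub>1\<close> the additional \<open>2\<close> pays for the initial error
    \<open>\<parallel>x0 - x\<parallel> \<le> 2 \<parallel>x\<parallel>\<close>, which has been reduced by the factor \<open>u\<close> after \<open>N\<close> iterations.\<close>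
  define C\<^sub>0 :: "real poly" where "C\<^sub>0 = monom 1024 2"
  define C :: "real poly" where "C = monom 2176 2"
  define C\<^sub>1 :: "real poly" where "C\<^sub>1 = monom 2176 2 + [:2:]"
  define N :: "real \<Rightarrow> real \<Rightarrow> nat" where "N \<kappa> u = nat \<lceil>2 * \<kappa>\<^sup>2 * ln (1 / u)\<rceil>" for \<kappa> u
  have C0: "poly C\<^sub>0 (real n) = 1024 * (real n)\<^sup>2" and C: "poly C (real n) = 2176 * (real n)\<^sup>2"
    and C1: "poly C\<^sub>1 (real n) = 2176 * (real n)\<^sup>2 + 2" for n
    by (simp_all add: C\<^sub>0_def C_def C\<^sub>1_def poly_monom)
  have pos: "\<forall>n\<ge>1::nat. poly C\<^sub>0 (real n) > 0 \<and> poly C (real n) > 0 \<and> poly C\<^sub>1 (real n) > 0"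
    unfolding C0 C C1 by (auto intro: add_nonneg_pos)
  have bound: "(\<forall>k. expected_error F A b x0 x k
              \<le> (1 - 1 / (2 * (demmel_cond A)\<^sup>2)) ^ k * vnorm (x0 - x)
                + poly C (real n) * vnorm x * (demmel_cond A)\<^sup>2 * u) \<and>
       (0 < u \<longrightarrow>
          real (N (demmel_cond A) u) \<le> 3 * (demmel_cond A)\<^sup>2 * ln (1 / u) \<and>
          expected_error F A b x0 x (N (demmel_cond A) u)
            \<le> poly C\<^sub>1 (real n) * vnorm x * (demmel_cond A)\<^sup>2 * u)"
    if n: "n \<ge> 1" and A: "A \<in> carrier_mat n n" "invertible_mat A"
      and b: "b \<in> carrier_vec n" and x: "x = inv_mat A *\<^sub>v b" and x0: "x0 \<in> carrier_vec n"
      and fp: "standard_fp_model u F"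
      and Afl: "\<forall>i<n. \<forall>j<n. A $$ (i, j) \<in> floats F"
      and bfl: "\<forall>i<n. b $ i \<in> floats F" and x0fl: "\<forall>i<n. x0 $ i \<in> floats F"
      and x0x: "vnorm x0 \<le> vnorm x"
      and small: "(demmel_cond A)\<^sup>2 * u \<le> 1 / poly C\<^sub>0 (real n)"
    for n :: nat and A b x x0 u F
  proof -
    let ?\<kappa> = "demmel_cond A"
    let ?E = "expected_error F A b x0 x"
    define t where "t = ?\<kappa>\<^sup>2"
    define X where "X = vnorm x"
    define c where "c = 272 * (real n)\<^sup>2 * u"
    note inv = inv_mat_inverse[OF A]
    have u0: "0 \<le> u" using fp by (simp add: standard_fp_model_def)
    have X: "0 \<le> X" by (simp add: X_def)
    have t: "1 \<le> t"
      using demmel_cond_ge_1[OF n A] by (simp add: t_def one_le_power)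
    have n2: "1 \<le> (real n)\<^sup>2" "real n \<le> (real n)\<^sup>2"
      using n by (simp_all add: one_le_power self_le_power)
    have tu: "1024 * (real n)\<^sup>2 * (t * u) \<le> 1"
      using small n by (simp add: C0 t_def field_simps)
    have "1024 * (real n)\<^sup>2 * u \<le> 1024 * (real n)\<^sup>2 * (t * u)"
      using t u0 mult_right_mono[of 1 t u] by (intro mult_left_mono) auto
    then have nsu: "1024 * (real n)\<^sup>2 * u \<le> 1" using tu by linarith
    have "u \<le> (real n)\<^sup>2 * u" and "real n * u \<le> (real n)\<^sup>2 * u"
      using mult_right_mono[OF n2(1) u0] mult_right_mono[OF n2(2) u0] by simp_all
    then have su: "1024 * u \<le> 1" and nu: "8 * real n * u \<le> 1"
      using nsu by linarith+
    have xc: "x \<in> carrier_vec n" using x inv(1) b by simp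
    have "A *\<^sub>v x = b"
      unfolding x using assoc_mult_mat_vec[OF A(1) inv(1) b] inv(2) b by simp
    then have bx: "b $ i = row A i \<bullet> x" if "i < n" for i
      using A(1) that by auto
    have E0: "?E 0 = vnorm (x0 - x)"
      by (simp add: expected_error_def)
    have E0X: "vnorm (x0 - x) \<le> 2 * X"
      using vnorm_minus_le[OF x0 xc] x0x by (simp add: X_def)
    have bound: "?E k \<le> (1 - 1 / (2 * t)) ^ k * vnorm (x0 - x) + 8 * c * t * X" for k
      unfolding E0[symmetric]
    proof (rule perturbed_contraction_bound[OF t _ _ X])
      show "0 \<le> c" using u0 by (simp add: c_def)
      have "c * t = 272 * ((real n)\<^sup>2 * (t * u))" by (simp add: c_def)
      then show "c * t \<le> 3/8" using tu by linarith
      show "?E 0 \<le> 2 * X" using E0 E0X by simp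
      show "?E (Suc k) \<le> (1 - 1 / (2 * t)) * ?E k + c * (X + ?E k)" for k
        unfolding t_def c_def X_def
        by (rule expected_error_Suc_le[OF fp n nu A _ xc bx _ x0]) (use Afl bfl x0fl in auto)
    qed
    have cC: "8 * c * t * X = poly C (real n) * vnorm x * ?\<kappa>\<^sup>2 * u"
      by (simp add: c_def t_def X_def C)
    have "real (N ?\<kappa> u) \<le> 3 * ?\<kappa>\<^sup>2 * ln (1 / u) \<and>
      ?E (N ?\<kappa> u) \<le> poly C\<^sub>1 (real n) * vnorm x * ?\<kappa>\<^sup>2 * u" if u: "0 < u"
    proof -
      \<comment> \<open>\<open>\<kappa>\<^sup>2 ln (1/u)\<close> is at least \<open>1\<close>, so one more copy of it pays for rounding \<open>N\<close> up.\<close>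
      have "u * exp 1 \<le> u * 3"
        using exp_le u by (intro mult_left_mono) auto
      then have "u * exp 1 \<le> 1"
        using su u by linarith
      then have "exp 1 \<le> 1 / u"
        using u by (simp add: pos_le_divide_eq mult.commute)
      then have ln1: "1 \<le> ln (1 / u)"
        using u by (simp add: ln_ge_iff)
      have "1 * 1 \<le> t * ln (1 / u)"
        using t ln1 by (intro mult_mono) auto
      then have tl: "1 \<le> t * ln (1 / u)" by simp
      have N: "2 * t * ln (1 / u) \<le> real (N ?\<kappa> u)" "real (N ?\<kappa> u) \<le> 2 * t * ln (1 / u) + 1"
        unfolding N_def t_def[symmetric] using tl by linarith+
      have "?E (N ?\<kappa> u) \<le> u * vnorm (x0 - x) + 8 * c * t * X"
        using bound[of "N ?\<kappa> u"]
          mult_right_mono[OF contraction_power_le_roundoff[OF t u N(1)], of "vnorm (x0 - x)"]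
        by simp
      also have "u * vnorm (x0 - x) \<le> (t * u) * (2 * X)"
        using t u X E0X mult_right_mono[of 1 t u] by (intro mult_mono) auto
      also have "(t * u) * (2 * X) + 8 * c * t * X = poly C\<^sub>1 (real n) * vnorm x * ?\<kappa>\<^sup>2 * u"
        by (simp add: C1 c_def t_def X_def algebra_simps)
      finally have "?E (N ?\<kappa> u) \<le> poly C\<^sub>1 (real n) * vnorm x * ?\<kappa>\<^sup>2 * u"
        by simp
      moreover have "real (N ?\<kappa> u) \<le> 3 * ?\<kappa>\<^sup>2 * ln (1 / u)"
        using N(2) tl by (simp add: t_def)
      ultimately show ?thesis by blast
    qed
    then show ?thesis using bound[unfolded cC, unfolded t_def] by blast
  qed
  have K: "(0::real) < 3" by simp
  show ?thesis
    by (intro exI[of _ C\<^sub>0] exI[of _ C] exI[of _ C\<^sub>1] exI[of _ "3::real"] exI[of _ N]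
        conjI[OF pos conjI[OF K]] allI impI) (rule bound)
qed

end
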